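(* Let $\Xi=\{\xi_k\}_{k\in\mathbb{Z}}$ be a stationary centered complex Gaussian process with $\gamma(0)=1$ and spectral measure $F$, and let $X_\Xi(z)=\sum_{k=0}^\infty\xi_kz^k$. Let $\operatorname{supp}F\subset\partial\mathbb{D}$ denote the (closed) support of $F$, viewed as a measure on the unit circle. Then, almost surely, the regular set of $X_\Xi$ (the set of all regular points of $X_\Xi$ on $\partial\mathbb{D}$) is equal to $(\operatorname{supp}F)^c=\partial\mathbb{D}\setminus\operatorname{supp}F$; i.e. $X_\Xi$ can be analytically extended outside the disk of convergence only across $(\operatorname{supp}F)^c$.
   Context: $\Xi=\{\xi_k\}_{k\in\mathbb{Z}}$ is a stationary, centered, (circularly symmetric) complex Gaussian process with covariance $\gamma(k-l)=\mathbb{E}[\xi_k\overline{\xi_l}]$ and $\gamma(0)=1$. Its spectral measure is the probability measure $F$ on $(-\pi,\pi]$ with $\gamma(k)=\int_{-\pi}^{\pi}e^{-ikt}F(dt)$ for all $k\in\mathbb{Z}$; $t\in(-\pi,\pi]$ is identified with $e^{it}\in\partial\mathbb{D}$, where $\mathbb{D}=\{|z|<1\}$. $F$ is not assumed absolutely continuous. The power series $X_\Xi$ has radius of convergence $1$ almost surely. For a power series $h$ with circle of convergence $\{|z|=\rho\}$, a point $b$ on this circle is singular if there does not exist any analytic continuation of $h$ across an arc of $\{|z|=\rho\}$ containing $b$; otherwise $b$ is regular. (An arc containing $b$ here means an open arc, so that $b$ is regular iff $h$ extends analytically to a neighbourhood of $b$.) The regular set is the totality of regular points. *)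

theory Defs
  imports "HOL-Probability.Probability" "HOL-Complex_Analysis.Complex_Analysis"
begin

section \<open>Stationary complex Gaussian processes indexed by the integers\<close>

text \<open>Real Gaussian variables may be degenerate (variance zero). This matters here: if the spectral
  measure has finite support, then the variables of the process are linearly dependent.\<close>

definition real_gaussian :: "'a measure \<Rightarrow> ('a \<Rightarrow> real) \<Rightarrow> bool" where
  "real_gaussian M Y \<longleftrightarrow> Y \<in> borel_measurable M \<and>
     (\<exists>\<mu> \<sigma>. (\<sigma> > 0 \<and> distributed M lborel Y (\<lambda>x. ennreal (normal_density \<mu> \<sigma> x))) \<or>
            (AE \<omega> in M. Y \<omega> = \<mu>))"

text \<open>The real and imaginary parts of all the variables are jointly Gaussian.\<close>

definition complex_gaussian_process :: "'a measure \<Rightarrow> (int \<Rightarrow> 'a \<Rightarrow> complex) \<Rightarrow> bool" where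
  "complex_gaussian_process M \<xi> \<longleftrightarrow>
     (\<forall>k. \<xi> k \<in> borel_measurable M) \<and>
     (\<forall>J a b. finite J \<longrightarrow>
        real_gaussian M (\<lambda>\<omega>. \<Sum>k\<in>J. a k * Re (\<xi> k \<omega>) + b k * Im (\<xi> k \<omega>)))"

definition centered :: "'a measure \<Rightarrow> (int \<Rightarrow> 'a \<Rightarrow> complex) \<Rightarrow> bool" where
  "centered M \<xi> \<longleftrightarrow> (\<forall>k. (LINT \<omega>|M. \<xi> k \<omega>) = 0)"

definition process_law :: "'a measure \<Rightarrow> (int \<Rightarrow> 'a \<Rightarrow> complex) \<Rightarrow> (int \<Rightarrow> complex) measure" where
  "process_law M \<xi> = distr M (\<Pi>\<^sub>M k\<in>UNIV. borel) (\<lambda>\<omega> k. \<xi> k \<omega>)"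

definition circularly_symmetric :: "'a measure \<Rightarrow> (int \<Rightarrow> 'a \<Rightarrow> complex) \<Rightarrow> bool" where
  "circularly_symmetric M \<xi> \<longleftrightarrow>
     (\<forall>\<theta>. process_law M (\<lambda>k \<omega>. cis \<theta> * \<xi> k \<omega>) = process_law M \<xi>)"

definition stationary :: "'a measure \<Rightarrow> (int \<Rightarrow> 'a \<Rightarrow> complex) \<Rightarrow> bool" where
  "stationary M \<xi> \<longleftrightarrow> (\<forall>n. process_law M (\<lambda>k. \<xi> (k + n)) = process_law M \<xi>)"

definition has_covariance ::
  "'a measure \<Rightarrow> (int \<Rightarrow> 'a \<Rightarrow> complex) \<Rightarrow> (int \<Rightarrow> complex) \<Rightarrow> bool" where
  "has_covariance M \<xi> \<gamma> \<longleftrightarrow> (\<forall>k l. \<gamma> (k - l) = (LINT \<omega>|M. \<xi> k \<omega> * cnj (\<xi> l \<omega>)))"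

definition spectral_measure :: "(int \<Rightarrow> complex) \<Rightarrow> real measure \<Rightarrow> bool" where
  "spectral_measure \<gamma> F \<longleftrightarrow>
     prob_space F \<and> sets F = sets (restrict_space borel {-pi<..pi}) \<and>
     (\<forall>k. \<gamma> k = (LINT t|F. exp (- (\<i> * of_int k * of_real t))))"

definition measure_support :: "'a::topological_space measure \<Rightarrow> 'a set" where
  "measure_support \<mu> = {x. \<forall>U. open U \<and> x \<in> U \<longrightarrow> emeasure \<mu> U > 0}"

text \<open>The image measure lives on the whole complex plane but is concentrated on the unit circle,
  so its support is a closed subset of the circle. Using the image under \<open>cis\<close> makes the points
  near \<open>-pi\<close> and \<open>pi\<close> neighbours.\<close>

definition circle_support :: "real measure \<Rightarrow> complex set" where
  "circle_support F = measure_support (distr F borel cis)"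

definition random_power_series :: "(int \<Rightarrow> 'a \<Rightarrow> complex) \<Rightarrow> 'a \<Rightarrow> complex fps" where
  "random_power_series \<xi> \<omega> = Abs_fps (\<lambda>k. \<xi> (int k) \<omega>)"


section \<open>Regular points of a power series\<close>

definition open_arcs :: "real \<Rightarrow> complex set set" where
  "open_arcs \<rho> = {rcis \<rho> ` {\<alpha><..<\<beta>} | \<alpha> \<beta>. \<alpha> < \<beta> \<and> \<beta> - \<alpha> \<le> 2 * pi}"

definition continues_across :: "complex fps \<Rightarrow> complex set \<Rightarrow> bool" where
  "continues_across h A \<longleftrightarrow>
     (\<exists>U g. open U \<and> A \<subseteq> U \<and> g holomorphic_on (eball 0 (fps_conv_radius h) \<union> U) \<and>
            (\<forall>z\<in>eball 0 (fps_conv_radius h). g z = eval_fps h z))"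

definition regular_set :: "complex fps \<Rightarrow> complex set" where
  "regular_set h =
     {b. \<exists>\<rho> A. \<rho> > 0 \<and> ereal \<rho> = fps_conv_radius h \<and> A \<in> open_arcs \<rho> \<and> b \<in> A \<and>
            continues_across h A}"

end

theory Submission
  imports Defs
begin

text \<open>Write \<open>X\<close> for the random power series. On the spectral side, a frequency \<open>u = cis t\<close>
  contributes the kernel \<open>1 / (1 - z / u)\<close>, which is singular exactly at \<open>u\<close>; the claim is that
  the superposition \<open>X\<close> of these kernels is singular exactly where there is spectral mass.

  Whether \<open>X\<close> is regular at a point \<open>b\<close> of the circle can be read off its Taylor series at
  \<open>b / 2\<close>. The disc of radius \<open>1/2\<close> around \<open>b / 2\<close> touches the unit circle only at \<open>b\<close>, so
  \<open>b\<close> is regular iff this Taylor series has a radius of convergence greater than \<open>1/2\<close>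
  (\<open>radius_at_half_gt\<close>, \<open>regular_if_radius_at_half_gt\<close>).

  The \<open>n\<close>-th Taylor coefficient at \<open>b / 2\<close> is an almost surely convergent linear combination of
  the \<open>\<xi>\<^sub>k\<close>. Because the covariance has a spectral representation, its second moment is
  \<open>\<integral> |u - b/2|^(-2(n + 1)) F(du)\<close>, up to the limit of partial sums
  (\<open>taylor_sum_variance_tendsto\<close>). If \<open>b\<close> is not in the support of \<open>F\<close>, then \<open>|u - b/2|\<close> stays
  above some \<open>s > 1/2\<close> and the second moments force a radius greater than \<open>1/2\<close>
  (\<open>AE_radius_at_half_outside_support\<close>). If \<open>b\<close> is in the support, then the second moments grow
  at least like \<open>(1/2 + e)^(-2n)\<close> for every \<open>e > 0\<close>. A Gaussian variable is unlikely to be much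
  smaller than its standard deviation, so by Borel--Cantelli the coefficients themselves grow that
  fast and the radius is at most \<open>1/2\<close> (\<open>AE_radius_at_half_on_support\<close>).

  These statements hold almost surely for each single \<open>b\<close>. The radius in the first case is
  deterministic, so a whole neighbourhood of \<open>b\<close> is regular and the Lindelof property leaves
  countably many neighbourhoods; in the second case a countable dense subset of the support is
  enough because regularity is an open condition.\<close>

section \<open>Re-expanding a power series at another point\<close>

text \<open>The formal rearrangement of \<open>\<Sum>k. h\<^sub>k (a + w)^k\<close> by powers of \<open>w\<close>. Being given
  by an explicit series, its coefficients are defined, and measurable in the coefficients of \<open>h\<close>,
  whether or not the rearrangement is legitimate.\<close>
definition recentred :: "complex fps \<Rightarrow> complex \<Rightarrow> complex fps" where
  "recentred h a = Abs_fps (\<lambda>n. \<Sum>k. of_nat ((n + k) choose n) * a ^ k * fps_nth h (n + k))"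

lemma fps_nth_higher_deriv:
  fixes h :: "complex fps"
  shows "fps_nth ((fps_deriv ^^ n) h) k = fact n * of_nat ((n + k) choose n) * fps_nth h (n + k)"
proof (induction n arbitrary: k)
  case (Suc n)
  have *: "Suc n * (Suc (n + k) choose Suc n) = Suc k * (Suc (n + k) choose n)"
    by (rule Suc_times_binomial_add)
  have "fps_nth ((fps_deriv ^^ Suc n) h) k =
      fact n * of_nat (Suc k * (Suc (n + k) choose n)) * fps_nth h (Suc n + k)"
    by (simp add: Suc.IH algebra_simps)
  then show ?case unfolding *[symmetric] by (simp add: algebra_simps)
qed auto

lemma higher_deriv_eval_fps:
  fixes h :: "complex fps"
  assumes "ereal (norm z) < fps_conv_radius h"
  shows "(deriv ^^ n) (eval_fps h) z = eval_fps ((fps_deriv ^^ n) h) z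
     \<and> fps_conv_radius h \<le> fps_conv_radius ((fps_deriv ^^ n) h)"
  using assms
proof (induction n arbitrary: z)
  case (Suc n)
  let ?h = "(fps_deriv ^^ n) h"
  have le: "fps_conv_radius h \<le> fps_conv_radius ?h"
    using Suc by blast
  have "eventually (\<lambda>w. w \<in> eball 0 (fps_conv_radius h)) (nhds z)"
    using Suc.prems by (intro eventually_nhds_in_open) auto
  then have "eventually (\<lambda>w. (deriv ^^ n) (eval_fps h) w = eval_fps ?h w) (nhds z)"
    by eventually_elim (simp add: Suc.IH)
  then have "deriv ((deriv ^^ n) (eval_fps h)) z = deriv (eval_fps ?h) z"
    by (rule deriv_cong_ev) simp
  also have "\<dots> = eval_fps (fps_deriv ?h) z"
    using le Suc.prems by (intro eval_fps_deriv[symmetric]) auto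
  finally show ?case
    using le fps_conv_radius_deriv[of ?h] order_trans by auto
qed auto

text \<open>Differentiating \<open>n\<close> times inside the disc of convergence and dividing by \<open>n!\<close> turns
  the formal rearrangement into the Taylor expansion at \<open>a\<close>. The second part records that the series
  defining each coefficient really converges.\<close>
lemma recentred_eq_fps_expansion:
  assumes "ereal (norm a) < fps_conv_radius h"
  shows "recentred h a = fps_expansion (eval_fps h) a"
    and "(\<lambda>k. of_nat ((n + k) choose n) * a ^ k * fps_nth h (n + k)) sums fps_nth (recentred h a) n"
proof -
  have *: "(\<lambda>k. of_nat ((n + k) choose n) * a ^ k * fps_nth h (n + k)) sums
      ((deriv ^^ n) (eval_fps h) a / fact n)" for n
  proof -
    have "(\<lambda>k. fps_nth ((fps_deriv ^^ n) h) k * a ^ k) sums ((deriv ^^ n) (eval_fps h) a)"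
      using higher_deriv_eval_fps[OF assms, of n] assms
      by (simp, intro sums_eval_fps) (auto intro: less_le_trans)
    from sums_divide[OF this, of "fact n"] show ?thesis
      by (simp add: fps_nth_higher_deriv mult_ac)
  qed
  show "recentred h a = fps_expansion (eval_fps h) a"
    unfolding recentred_def fps_expansion_def using *[THEN sums_unique] by simp
  show "(\<lambda>k. of_nat ((n + k) choose n) * a ^ k * fps_nth h (n + k)) sums fps_nth (recentred h a) n"
    using * sums_unique[OF *] by (simp add: recentred_def)
qed

text \<open>The rearrangement of the geometric series; it gives the Taylor coefficients of the
  kernel \<open>1 / (1 - u z)\<close>, which is what a single spectral frequency contributes.\<close>
lemma negative_binomial_series:
  fixes z :: complex
  assumes "norm z < 1"
  shows "(\<lambda>k. of_nat ((n + k) choose n) * z ^ k) sums (1 / (1 - z) ^ Suc n)"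
proof -
  let ?s = "- of_nat (Suc n) :: complex"
  have "(\<lambda>k. (?s gchoose k) * (- z) ^ k) sums (1 + (- z)) powr ?s"
    using assms by (intro gen_binomial_complex) auto
  also have "(\<lambda>k. (?s gchoose k) * (- z) ^ k) = (\<lambda>k. of_nat ((n + k) choose n) * z ^ k)"
  proof
    fix k
    have "(?s gchoose k) = (-1) ^ k * of_nat ((n + k) choose n)"
      using gbinomial_minus[of "of_nat (Suc n) :: complex" k] binomial_symmetric[of n "n + k"]
      by (simp add: binomial_gbinomial algebra_simps)
    then show "(?s gchoose k) * (- z) ^ k = of_nat ((n + k) choose n) * z ^ k"
      by (simp add: power_minus[of z] mult_ac)
  qed
  also have "(1 + (- z)) powr ?s = 1 / (1 - z) ^ Suc n"
  proof -
    have "1 - z \<noteq> 0" using assms by auto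
    then show ?thesis
      by (simp add: powr_minus powr_nat' divide_simps del: of_nat_Suc power_Suc)
  qed
  finally show ?thesis .
qed

section \<open>Regular points and the radius of convergence at a midpoint\<close>

text \<open>Regularity is phrased with arcs; a neighbourhood of the point is more convenient. This
  lemma and the next one pass between the two.\<close>
lemma regular_if_continues_near:
  assumes rad: "fps_conv_radius h = 1" and b: "norm b = 1"
    and U: "open U" "b \<in> U" "g holomorphic_on (ball 0 1 \<union> U)"
    and eq: "\<And>z. z \<in> ball 0 1 \<Longrightarrow> g z = eval_fps h z"
  shows "b \<in> regular_set h"
proof -
  obtain \<theta> where \<theta>: "b = cis \<theta>" using b
    by (metis rcis_cmod_Arg rcis_def mult_1 of_real_1)
  have "open (cis -` U)"
    by (intro open_vimage U continuous_intros)
  then obtain e where e: "e > 0" "ball \<theta> e \<subseteq> cis -` U"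
    using U \<theta> by (metis openE vimageI)
  define d where "d = min e pi"
  have d: "d > 0" "d \<le> pi" "d \<le> e" using e by (auto simp: d_def)
  let ?A = "rcis 1 ` {\<theta> - d <..< \<theta> + d}"
  have "?A \<subseteq> U"
    using e(2) d by (auto simp: rcis_def dist_real_def subset_iff)
  moreover have "?A \<in> open_arcs 1"
    unfolding open_arcs_def using d by (intro CollectI exI[of _ "\<theta> - d"] exI[of _ "\<theta> + d"]) auto
  moreover have "b \<in> ?A" using d \<theta> by (auto simp: rcis_def)
  moreover have "continues_across h ?A"
    unfolding continues_across_def rad
    using U eq calculation by (intro exI[of _ U] exI[of _ g]) (auto simp: one_ereal_def)
  ultimately show ?thesis
    unfolding regular_set_def rad by (intro CollectI exI[of _ 1] exI[of _ ?A]) (auto simp: one_ereal_def)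
qed

lemma continues_near_if_regular:
  assumes "b \<in> regular_set h" and "fps_conv_radius h = 1"
  obtains U g where "norm b = 1" "open U" "b \<in> U" "g holomorphic_on (ball 0 1 \<union> U)"
    "\<And>z. z \<in> ball 0 1 \<Longrightarrow> g z = eval_fps h z"
proof -
  from assms obtain A where A: "A \<in> open_arcs 1" "b \<in> A" "continues_across h A"
    unfolding regular_set_def by (auto simp: one_ereal_def)
  then obtain U g where "open U" "A \<subseteq> U" "g holomorphic_on (ball 0 1 \<union> U)"
    "\<And>z. z \<in> ball 0 1 \<Longrightarrow> g z = eval_fps h z"
    unfolding continues_across_def assms(2) by (auto simp: one_ereal_def)
  moreover have "norm b = 1" using A by (auto simp: open_arcs_def rcis_def)
  ultimately show ?thesis using A that by blast
qed

text \<open>The closed disc with diameter \<open>[0, b]\<close> touches the unit circle only at \<open>b\<close>. If the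
  function extends past \<open>b\<close>, it is therefore holomorphic on a neighbourhood of this compact disc, hence
  on a strictly larger concentric disc, and the Taylor series at the centre \<open>b / 2\<close> converges there.\<close>
lemma radius_at_half_gt:
  assumes b: "norm b = 1" and rad: "fps_conv_radius h \<ge> 1"
    and V: "open V" "ball 0 1 \<subseteq> V" "b \<in> V" "g holomorphic_on V"
    and eq: "\<And>z. z \<in> ball 0 1 \<Longrightarrow> g z = eval_fps h z"
  shows "fps_conv_radius (recentred h (b / 2)) > ereal (1 / 2)"
proof -
  have sub: "cball (b/2) (1/2) \<subseteq> V"
  proof
    fix z assume "z \<in> cball (b/2) (1/2)"
    then have z: "norm (b/2 - z) \<le> 1/2" by (auto simp: dist_norm)
    \<comment> \<open>Thales' theorem in quantitative form, from the parallelogram identity\<close>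
    have par: "(norm z)\<^sup>2 + (norm (b - z))\<^sup>2 = 2 * (norm (b/2))\<^sup>2 + 2 * (norm (b/2 - z))\<^sup>2"
      unfolding cmod_power2 by (simp add: power2_eq_square field_simps)
    have "(norm (b/2 - z))\<^sup>2 \<le> (1/2)\<^sup>2" using z by (intro power_mono) auto
    with par b have le: "(norm z)\<^sup>2 + (norm (b - z))\<^sup>2 \<le> 1"
      by (simp add: norm_divide power2_eq_square)
    show "z \<in> V"
    proof (cases "z = b")
      case False
      then have "(norm (b - z))\<^sup>2 > 0" by simp
      then have "(norm z)\<^sup>2 < 1" using le by linarith
      then have "(norm z)\<^sup>2 < 1\<^sup>2" by simp
      then have "norm z < 1" by (rule power_less_imp_less_base) simp
      then show ?thesis using V by auto
    qed (use V in auto)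
  qed
  then obtain e where e: "e > 0" "(\<Union>x\<in>cball (b/2) (1/2). ball x e) \<subseteq> V"
    using compact_subset_open_imp_ball_epsilon_subset[of "cball (b/2) (1/2)" V] V by auto
  have "ball (b/2) (1/2 + e) \<subseteq> V"
  proof
    fix z assume z: "z \<in> ball (b/2) (1/2 + e)"
    show "z \<in> V"
    proof (cases "z \<in> cball (b/2) (1/2)")
      case False
      define n where "n = norm (z - b/2)"
      have n: "n > 1/2" "n < 1/2 + e"
        using False z by (auto simp: dist_norm norm_minus_commute n_def)
      \<comment> \<open>the point of the smaller closed disc closest to \<open>z\<close>\<close>
      define x where "x = b/2 + of_real (1 / (2*n)) * (z - b/2)"
      have "x \<in> cball (b/2) (1/2)"
        using n by (auto simp: x_def dist_norm norm_mult norm_divide simp flip: n_def)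
      moreover have "z - x = of_real (1 - 1/(2*n)) * (z - b/2)"
        by (simp add: x_def algebra_simps)
      then have "norm (z - x) = \<bar>1 - 1/(2*n)\<bar> * n"
        unfolding n_def by (simp only: norm_mult norm_of_real)
      then have "norm (z - x) = n - 1/2"
      proof -
        have "\<bar>1 - 1/(2*n)\<bar> = 1 - 1/(2*n)" using n by (simp add: field_simps)
        moreover have "(1 - 1/(2*n)) * n = n - 1/2" using n by (simp add: field_simps)
        ultimately show ?thesis using \<open>norm (z - x) = \<bar>1 - 1/(2*n)\<bar> * n\<close> by simp
      qed
      then have "z \<in> ball x e" using n by (simp add: dist_norm norm_minus_commute)
      ultimately show ?thesis using e by blast
    qed (use sub in auto)
  qed
  then have hol: "g holomorphic_on eball (b/2) (ereal (1/2 + e))"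
    using V holomorphic_on_subset by auto
  have half: "b/2 \<in> ball 0 1" using b by (auto simp: norm_divide)
  have "eventually (\<lambda>z. z \<in> ball 0 1) (nhds (b/2))"
    using half by (intro eventually_nhds_in_open) auto
  then have ev: "eventually (\<lambda>z. g z = eval_fps h z) (nhds (b/2))"
    by eventually_elim (rule eq)
  have "recentred h (b/2) = fps_expansion (eval_fps h) (b/2)"
  proof (rule recentred_eq_fps_expansion)
    have "ereal (norm (b/2)) < ereal 1" unfolding less_ereal.simps using half by simp
    then have "ereal (norm (b/2)) < 1" unfolding one_ereal_def .
    with rad show "ereal (norm (b/2)) < fps_conv_radius h" by (rule less_le_trans[rotated])
  qed
  also have "\<dots> = fps_expansion g (b/2)"
    using ev by (intro fps_expansion_cong) (auto elim: eventually_mono)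
  finally have "fps_conv_radius (recentred h (b/2)) \<ge> ereal (1/2 + e)"
    using conv_radius_fps_expansion[OF hol] by simp
  moreover have "ereal (1/2) < ereal (1/2 + e)" using e by simp
  ultimately show ?thesis by (rule less_le_trans[rotated])
qed

text \<open>Conversely, a Taylor series at \<open>b / 2\<close> with radius greater than \<open>1/2\<close> continues the
  function beyond the circle. The conclusion concerns every point \<open>c\<close> of the circle inside the larger
  disc and not only \<open>b\<close>: the radius \<open>r\<close> will be deterministic, so that one exceptional event
  serves a whole neighbourhood of \<open>b\<close>.\<close>
lemma regular_if_radius_at_half_gt:
  assumes b: "norm b = 1" and rad: "fps_conv_radius h = 1"
    and R: "fps_conv_radius (recentred h (b / 2)) \<ge> ereal r" "r > 1 / 2"
    and c: "norm c = 1" "c \<in> ball (b / 2) r"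
  shows "c \<in> regular_set h"
proof -
  let ?B = "ball (b/2) r"
  define p where "p = (\<lambda>z. eval_fps (recentred h (b/2)) (z - b/2))"
  define g where "g = (\<lambda>z. if z \<in> ball 0 1 then eval_fps h z else p z)"
  have half: "ereal (norm (b/2)) < fps_conv_radius h"
    using b rad by (auto simp: norm_divide one_ereal_def)
  have p: "p holomorphic_on ?B"
    unfolding p_def
  proof (rule holomorphic_on_compose_gen[of "\<lambda>z. z - b/2", unfolded o_def])
    show "eval_fps (recentred h (b/2)) holomorphic_on eball 0 (fps_conv_radius (recentred h (b/2)))"
      by (rule holomorphic_on_eval_fps) simp
    show "(\<lambda>z. z - b/2) ` ?B \<subseteq> eball 0 (fps_conv_radius (recentred h (b/2)))"
    proof (rule image_subsetI)
      fix z assume "z \<in> ?B"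
      then have "ereal (norm (z - b/2)) < ereal r" by (simp add: dist_norm norm_minus_commute)
      also note R(1)
      finally show "z - b/2 \<in> eball 0 (fps_conv_radius (recentred h (b/2)))" by simp
    qed
  qed (intro holomorphic_intros)
  have f: "eval_fps h holomorphic_on ball 0 1"
    by (intro holomorphic_intros) (auto simp: rad one_ereal_def)
  have eq: "eval_fps h z = p z" if z: "z \<in> ball 0 1 \<inter> ?B" for z
  proof -
    \<comment> \<open>both functions agree on this disc, hence on the convex set \<open>ball 0 1 \<inter> ?B\<close>\<close>
    have sub: "ball (b/2) (1/2) \<subseteq> ball 0 1 \<inter> ?B"
    proof -
      have "ball (b/2) (1/2) \<subseteq> ball 0 1"
        using b by (simp add: ball_subset_ball_iff norm_divide dist_norm)
      moreover have "ball (b/2) (1/2) \<subseteq> ?B" using R by (intro subset_ball) auto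
      ultimately show ?thesis by blast
    qed
    have near: "eval_fps h z = p z" if "z \<in> ball (b/2) (1/2)" for z
      unfolding p_def recentred_eq_fps_expansion(1)[OF half]
      using that sub f by (intro eval_fps_expansion[where r = "1/2", symmetric])
        (auto simp: one_ereal_def numeral_eq_ereal divide_ereal_def intro: holomorphic_on_subset)
    show ?thesis
      using analytic_continuation_open[of "ball (b/2) (1/2)" "ball 0 1 \<inter> ?B" "eval_fps h" p z]
        near sub z f p by (auto intro: holomorphic_on_subset convex_connected convex_Int)
  qed
  have "g holomorphic_on (ball 0 1 \<union> ?B)"
    unfolding g_def using f p eq by (intro holomorphic_on_If_Un) auto
  then show ?thesis
    using c rad by (intro regular_if_continues_near[where U = ?B and g = g]) (auto simp: g_def)
qed

section \<open>Radius of convergence of random power series\<close>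

text \<open>If the second moments decay like \<open>q^n\<close> and \<open>r\<^sup>2 q < 1\<close>, then
  \<open>\<Sum>n. |c\<^sub>n|\<^sup>2 r^(2n)\<close> has finite expectation, so it is almost surely finite
  and \<open>c\<^sub>n r^n\<close> is bounded.\<close>
lemma (in prob_space) AE_conv_radius_ge_if_second_moments:
  fixes c :: "nat \<Rightarrow> 'a \<Rightarrow> complex"
  assumes [measurable]: "\<And>n. c n \<in> borel_measurable M"
    and mom: "\<And>n. (\<integral>\<^sup>+\<omega>. ennreal ((norm (c n \<omega>))\<^sup>2) \<partial>M) \<le> ennreal (K * q ^ n)"
    and K: "K \<ge> 0" "q \<ge> 0" "r > 0" "r\<^sup>2 * q < 1"
  shows "AE \<omega> in M. conv_radius (\<lambda>n. c n \<omega>) \<ge> ereal r"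
proof -
  let ?f = "\<lambda>n \<omega>. ennreal ((norm (c n \<omega> * r ^ n))\<^sup>2)"
  have term_le: "(\<integral>\<^sup>+\<omega>. ?f n \<omega> \<partial>M) \<le> ennreal (K * (r\<^sup>2 * q) ^ n)" for n
  proof -
    have "(\<integral>\<^sup>+\<omega>. ?f n \<omega> \<partial>M) = (\<integral>\<^sup>+\<omega>. ennreal ((r\<^sup>2) ^ n) * ennreal ((norm (c n \<omega>))\<^sup>2) \<partial>M)"
      using K by (simp add: norm_mult norm_power power_mult_distrib power_mult[symmetric] mult.commute
          ennreal_mult[symmetric])
    also have "\<dots> = ennreal ((r\<^sup>2) ^ n) * (\<integral>\<^sup>+\<omega>. ennreal ((norm (c n \<omega>))\<^sup>2) \<partial>M)"
      by (intro nn_integral_cmult) measurable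
    also have "\<dots> \<le> ennreal ((r\<^sup>2) ^ n) * ennreal (K * q ^ n)"
      by (intro mult_left_mono mom) simp
    also have "\<dots> = ennreal (K * (r\<^sup>2 * q) ^ n)"
      using K by (simp add: ennreal_mult[symmetric] power_mult_distrib mult_ac)
    finally show ?thesis .
  qed
  have "(\<integral>\<^sup>+\<omega>. (\<Sum>n. ?f n \<omega>) \<partial>M) = (\<Sum>n. \<integral>\<^sup>+\<omega>. ?f n \<omega> \<partial>M)"
    by (intro nn_integral_suminf) measurable
  also have "\<dots> \<le> (\<Sum>n. ennreal (K * (r\<^sup>2 * q) ^ n))"
    by (intro suminf_le term_le) auto
  also have "\<dots> < \<infinity>"
    using K by (subst suminf_ennreal2) (auto intro!: summable_mult summable_geometric)
  finally have "(\<integral>\<^sup>+\<omega>. (\<Sum>n. ?f n \<omega>) \<partial>M) \<noteq> \<infinity>" by simp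
  then have "AE \<omega> in M. (\<Sum>n. ?f n \<omega>) \<noteq> \<infinity>"
    by (intro nn_integral_noteq_infinite) measurable
  then show ?thesis
  proof eventually_elim
    case (elim \<omega>)
    then have "summable (\<lambda>n. (norm (c n \<omega> * r ^ n))\<^sup>2)"
      by (intro summable_suminf_not_top) (auto simp: infinity_ennreal_def)
    then have "(\<lambda>n. (norm (c n \<omega> * r ^ n))\<^sup>2) \<longlonglongrightarrow> 0" by (rule summable_LIMSEQ_zero)
    then have "(\<lambda>n. sqrt ((norm (c n \<omega> * r ^ n))\<^sup>2)) \<longlonglongrightarrow> sqrt 0"
      by (rule tendsto_real_sqrt)
    then have "Bseq (\<lambda>n. c n \<omega> * r ^ n)"
      by (auto simp: tendsto_norm_zero_iff intro: convergent_imp_Bseq convergentI)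
    then obtain B where B: "\<And>n. norm (c n \<omega> * r ^ n) \<le> B" unfolding Bseq_def by blast
    show ?case
    proof (rule conv_radius_geI_ex)
      fix s :: real assume s: "0 < s" "ereal s < ereal r"
      have "summable (\<lambda>n. c n \<omega> * of_real s ^ n)"
      proof (rule summable_comparison_test')
        show "summable (\<lambda>n. B * (s / r) ^ n)"
          using s by (intro summable_mult summable_geometric) auto
        fix n
        have "norm (c n \<omega> * of_real s ^ n) = norm (c n \<omega> * r ^ n) * (s / r) ^ n"
          using s K by (simp add: norm_mult norm_power power_divide)
        then show "norm (c n \<omega> * of_real s ^ n) \<le> B * (s / r) ^ n"
          using B[of n] s K by (auto intro: mult_right_mono)
      qed
      then show "\<exists>z. norm z = s \<and> summable (\<lambda>n. c n \<omega> * z ^ n)"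
        using s by (intro exI[of _ "of_real s"]) auto
    qed
  qed
qed

text \<open>If \<open>c\<^sub>n\<close> is unlikely to be much smaller than \<open>s^(-n)\<close>, then by the
  Borel--Cantelli lemma eventually \<open>|c\<^sub>n| \<ge> r^(-n)\<close>, and the series diverges at \<open>r\<close>.\<close>
lemma (in prob_space) AE_conv_radius_le_if_small_ball:
  fixes c :: "nat \<Rightarrow> 'a \<Rightarrow> complex"
  assumes [measurable]: "\<And>n. c n \<in> borel_measurable M"
    and ball: "\<And>n e. e > 0 \<Longrightarrow> prob {\<omega>\<in>space M. norm (c n \<omega>) < e} \<le> K * e * s ^ n"
    and s: "0 < s" "s < r"
  shows "AE \<omega> in M. conv_radius (\<lambda>n. c n \<omega>) \<le> ereal r"
proof -
  let ?A = "\<lambda>n. {\<omega>\<in>space M. norm (c n \<omega>) < (1 / r) ^ n}"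
  have "AE \<omega> in M. eventually (\<lambda>n. \<omega> \<in> space M - ?A n) sequentially"
  proof (rule borel_cantelli_AE1)
    show "summable (\<lambda>n. measure M (?A n))"
    proof (rule summable_comparison_test')
      show "summable (\<lambda>n. K * (s / r) ^ n)"
        using s by (intro summable_mult summable_geometric) auto
      show "norm (measure M (?A n)) \<le> K * (s / r) ^ n" for n
        using ball[of "(1 / r) ^ n" n] s by (simp add: power_divide)
    qed
  qed (auto simp: emeasure_eq_measure)
  then show ?thesis
  proof eventually_elim
    case (elim \<omega>)
    have "\<not> summable (\<lambda>n. c n \<omega> * of_real r ^ n)"
    proof
      assume "summable (\<lambda>n. c n \<omega> * of_real r ^ n)"
      then have "(\<lambda>n. norm (c n \<omega> * of_real r ^ n)) \<longlonglongrightarrow> 0"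
        by (intro tendsto_norm_zero summable_LIMSEQ_zero)
      then have "eventually (\<lambda>n. norm (c n \<omega> * of_real r ^ n) < 1) sequentially"
        by (rule order_tendstoD) simp
      with elim have "eventually (\<lambda>n. False) sequentially"
        by eventually_elim (use s in \<open>auto simp: norm_mult norm_power power_divide field_simps\<close>)
      then show False by simp
    qed
    from conv_radius_leI'[OF this] show ?case using s by simp
  qed
qed

section \<open>Processes with a spectral representation of the covariance\<close>

text \<open>A positive second moment and mean zero exclude the degenerate alternative, and the
  density of the remaining normal law is at most \<open>1 / (2\<sigma>)\<close>.\<close>
lemma (in prob_space) real_gaussian_small_ball:
  assumes Y: "real_gaussian M Y" "integrable M (\<lambda>\<omega>. (Y \<omega>)\<^sup>2)" "expectation Y = 0"
    and w: "0 < w" "w \<le> expectation (\<lambda>\<omega>. (Y \<omega>)\<^sup>2)" and e: "e > 0"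
  shows "prob {\<omega>\<in>space M. \<bar>Y \<omega>\<bar> < e} \<le> e / sqrt w"
proof -
  from Y have [measurable]: "Y \<in> borel_measurable M" by (simp add: real_gaussian_def)
  have "\<not> (AE \<omega> in M. Y \<omega> = \<mu>)" for \<mu>
  proof
    assume AE: "AE \<omega> in M. Y \<omega> = \<mu>"
    then have "expectation Y = expectation (\<lambda>_. \<mu>)" by (intro integral_cong_AE) auto
    with Y have "\<mu> = 0" by (simp add: prob_space)
    with AE have "expectation (\<lambda>\<omega>. (Y \<omega>)\<^sup>2) = expectation (\<lambda>_. 0)"
      by (intro integral_cong_AE) auto
    with w show False by simp
  qed
  then obtain \<mu> \<sigma> where \<sigma>: "\<sigma> > 0"
    and D: "distributed M lborel Y (\<lambda>x. ennreal (normal_density \<mu> \<sigma> x))"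
    using Y by (auto simp: real_gaussian_def)
  have "\<mu> = 0" using normal_distributed_expectation[OF \<sigma> D] Y by simp
  moreover have "\<sigma>\<^sup>2 = expectation (\<lambda>\<omega>. (Y \<omega>)\<^sup>2)"
    using normal_distributed_variance[OF \<sigma> D] Y by simp
  ultimately have sw: "sqrt w \<le> \<sigma>" using w \<sigma> by (metis real_sqrt_le_mono real_sqrt_abs abs_of_pos)
  have dens: "normal_density \<mu> \<sigma> x \<le> 1 / (2 * \<sigma>)" for x
  proof -
    have "2 * \<sigma> = sqrt (4 * \<sigma>\<^sup>2)" using \<sigma> by (simp add: real_sqrt_mult)
    also have "\<dots> \<le> sqrt (2 * pi * \<sigma>\<^sup>2)"
      using pi_gt3 by (intro real_sqrt_le_mono mult_right_mono) auto
    finally have "1 / sqrt (2 * pi * \<sigma>\<^sup>2) \<le> 1 / (2 * \<sigma>)" using \<sigma> by (intro divide_left_mono) auto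
    moreover have "normal_density \<mu> \<sigma> x \<le> 1 / sqrt (2 * pi * \<sigma>\<^sup>2) * 1"
      unfolding normal_density_def by (intro mult_left_mono) auto
    ultimately show ?thesis by simp
  qed
  have "emeasure M {\<omega>\<in>space M. \<bar>Y \<omega>\<bar> < e} = emeasure M (Y -` {-e<..<e} \<inter> space M)"
    by (intro arg_cong[of _ _ "emeasure M"]) auto
  also have "\<dots> = (\<integral>\<^sup>+x. ennreal (normal_density \<mu> \<sigma> x) * indicator {-e<..<e} x \<partial>lborel)"
    using D by (intro distributed_emeasure) auto
  also have "\<dots> \<le> (\<integral>\<^sup>+x. ennreal (1 / (2 * \<sigma>)) * indicator {-e<..<e} x \<partial>lborel)"
    by (intro nn_integral_mono mult_right_mono ennreal_leI dens) auto
  also have "\<dots> = ennreal (1 / (2 * \<sigma>)) * ennreal (2 * e)"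
    using e by (simp add: nn_integral_cmult)
  also have "\<dots> = ennreal (e / \<sigma>)" using \<sigma> e by (simp add: ennreal_mult[symmetric])
  finally have "prob {\<omega>\<in>space M. \<bar>Y \<omega>\<bar> < e} \<le> e / \<sigma>"
    using \<sigma> e by (simp add: emeasure_eq_measure)
  also have "\<dots> \<le> e / sqrt w" using sw e w \<sigma> by (intro divide_left_mono) auto
  finally show ?thesis .
qed

lemma cis_measurable [measurable]: "cis \<in> borel_measurable borel"
  using borel_measurable_continuous_onI[OF continuous_on_cis[OF continuous_on_id]] by simp

locale spectral_gaussian_process = prob_space M for M :: "'a measure" +
  fixes \<xi> :: "int \<Rightarrow> 'a \<Rightarrow> complex" and F :: "real measure"
  assumes gaussian: "complex_gaussian_process M \<xi>"
    and cent: "centered M \<xi>"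
    and cov: "\<And>k l. (LINT \<omega>|M. \<xi> k \<omega> * cnj (\<xi> l \<omega>)) = (LINT t|F. cis (- (of_int (k - l) * t)))"
    and prob_F: "prob_space F"
    and sets_F: "sets F = sets (restrict_space borel {-pi<..pi})"
begin

sublocale F: prob_space F by (rule prob_F)

lemma xi_measurable [measurable]: "\<xi> k \<in> borel_measurable M"
  using gaussian by (simp add: complex_gaussian_process_def)

lemma id_measurable_F [measurable]: "(\<lambda>t. t) \<in> borel_measurable F"
  by (subst measurable_cong_sets[OF sets_F refl]) (rule measurable_restrict_space1, simp)

lemma cis_measurable_F [measurable]: "cis \<in> borel_measurable F"
  by (rule measurable_compose[OF id_measurable_F cis_measurable])

text \<open>An expectation that does not exist would be \<open>0\<close> by convention, whereas the variance is
  the total mass \<open>1\<close> of the spectral measure.\<close>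
lemma xi_square_integrable: "integrable M (\<lambda>\<omega>. (norm (\<xi> k \<omega>))\<^sup>2)"
proof -
  have "(LINT \<omega>|M. \<xi> k \<omega> * cnj (\<xi> k \<omega>)) \<noteq> 0"
    unfolding cov using F.prob_space by simp
  then have "integrable M (\<lambda>\<omega>. \<xi> k \<omega> * cnj (\<xi> k \<omega>))"
    using not_integrable_integral_eq by blast
  then have "integrable M (\<lambda>\<omega>. norm (\<xi> k \<omega> * cnj (\<xi> k \<omega>)))" by (rule integrable_norm)
  then show ?thesis by (simp add: norm_mult power2_eq_square)
qed

lemma linear_form_gaussian:
  "finite J \<Longrightarrow> real_gaussian M (\<lambda>\<omega>. \<Sum>k\<in>J. a k * Re (\<xi> k \<omega>) + b k * Im (\<xi> k \<omega>))"
  using gaussian by (simp add: complex_gaussian_process_def)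

lemma xi_cross_integrable: "integrable M (\<lambda>\<omega>. \<xi> k \<omega> * cnj (\<xi> l \<omega>))"
proof (rule Bochner_Integration.integrable_bound)
  show "integrable M (\<lambda>\<omega>. (norm (\<xi> k \<omega>))\<^sup>2 + (norm (\<xi> l \<omega>))\<^sup>2)"
    by (intro Bochner_Integration.integrable_add xi_square_integrable)
  have "norm (\<xi> k \<omega> * cnj (\<xi> l \<omega>)) \<le> (norm (\<xi> k \<omega>))\<^sup>2 + (norm (\<xi> l \<omega>))\<^sup>2" for \<omega>
    using sum_squares_bound[of "norm (\<xi> k \<omega>)" "norm (\<xi> l \<omega>)"]
      mult_nonneg_nonneg[OF norm_ge_zero[of "\<xi> k \<omega>"] norm_ge_zero[of "\<xi> l \<omega>"]]
    unfolding norm_mult complex_mod_cnj by linarith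
  then show "AE \<omega> in M. norm (\<xi> k \<omega> * cnj (\<xi> l \<omega>)) \<le> norm ((norm (\<xi> k \<omega>))\<^sup>2 + (norm (\<xi> l \<omega>))\<^sup>2)"
    by simp
  have [measurable]: "cnj \<in> borel_measurable borel"
    by (intro borel_measurable_continuous_onI continuous_on_cnj continuous_on_id)
  show "(\<lambda>\<omega>. \<xi> k \<omega> * cnj (\<xi> l \<omega>)) \<in> borel_measurable M" by measurable
qed

lemma xi_integrable: "integrable M (\<xi> k)"
proof -
  have "integrable M (\<lambda>\<omega>. norm (\<xi> k \<omega>))"
    by (rule square_integrable_imp_integrable) (use xi_square_integrable in auto)
  then show ?thesis by (simp add: integrable_norm_iff)
qed

text \<open>Both sides are the same quadratic form in the coefficients: the spectral representation of
  the covariance says that \<open>\<xi>\<^sub>k \<mapsto> exp (- i k t)\<close> preserves inner products.\<close>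
lemma spectral_isometry:
  assumes "finite J"
  shows "integrable M (\<lambda>\<omega>. (norm (\<Sum>k\<in>J. a k * \<xi> k \<omega>))\<^sup>2)"
    and "(LINT \<omega>|M. (norm (\<Sum>k\<in>J. a k * \<xi> k \<omega>))\<^sup>2)
      = (LINT t|F. (norm (\<Sum>k\<in>J. a k * cis (- (of_int k * t))))\<^sup>2)"
proof -
  have expand: "complex_of_real ((norm (\<Sum>k\<in>J. a k * x k))\<^sup>2)
      = (\<Sum>k\<in>J. \<Sum>l\<in>J. (a k * cnj (a l)) * (x k * cnj (x l)))" for x :: "int \<Rightarrow> complex"
    by (simp only: complex_norm_square cnj_sum sum_product complex_cnj_mult) (simp add: mult_ac)
  have "integrable M (\<lambda>\<omega>. complex_of_real ((norm (\<Sum>k\<in>J. a k * \<xi> k \<omega>))\<^sup>2))"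
    unfolding expand using xi_cross_integrable by auto
  then show "integrable M (\<lambda>\<omega>. (norm (\<Sum>k\<in>J. a k * \<xi> k \<omega>))\<^sup>2)"
    by (simp only: complex_of_real_integrable_eq)
  have ciseq: "cis (- (of_int k * t)) * cnj (cis (- (of_int l * t))) = cis (- (of_int (k - l) * t))"
    for k l t by (simp add: cis_cnj cis_mult algebra_simps)
  have cisint: "integrable F (\<lambda>t. cis (- (of_int k * t)) * cnj (cis (- (of_int l * t))))" for k l
    unfolding ciseq by (rule F.integrable_const_bound[where B = 1]) (simp, measurable)
  have "complex_of_real (LINT \<omega>|M. (norm (\<Sum>k\<in>J. a k * \<xi> k \<omega>))\<^sup>2)
      = (\<Sum>k\<in>J. \<Sum>l\<in>J. (a k * cnj (a l)) * (LINT \<omega>|M. \<xi> k \<omega> * cnj (\<xi> l \<omega>)))"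
    unfolding integral_complex_of_real[symmetric] expand using xi_cross_integrable
    by (simp add: Bochner_Integration.integral_sum)
  also have "\<dots> = (\<Sum>k\<in>J. \<Sum>l\<in>J. (a k * cnj (a l)) *
      (LINT t|F. cis (- (of_int k * t)) * cnj (cis (- (of_int l * t)))))"
    unfolding cov ciseq ..
  also have "\<dots> = complex_of_real (LINT t|F. (norm (\<Sum>k\<in>J. a k * cis (- (of_int k * t))))\<^sup>2)"
    unfolding integral_complex_of_real[symmetric] expand using cisint
    by (simp add: Bochner_Integration.integral_sum)
  finally show "(LINT \<omega>|M. (norm (\<Sum>k\<in>J. a k * \<xi> k \<omega>))\<^sup>2)
      = (LINT t|F. (norm (\<Sum>k\<in>J. a k * cis (- (of_int k * t))))\<^sup>2)"
    by (simp only: of_real_eq_iff)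
qed

text \<open>One of the real and imaginary parts carries at least half of the second moment, and that
  part is real Gaussian.\<close>
lemma small_ball_finite:
  assumes J: "finite J" and v: "0 < v" "v \<le> (LINT \<omega>|M. (norm (\<Sum>k\<in>J. a k * \<xi> k \<omega>))\<^sup>2)" and e: "e > 0"
  shows "prob {\<omega>\<in>space M. norm (\<Sum>k\<in>J. a k * \<xi> k \<omega>) < e} \<le> 2 * e / sqrt v"
proof -
  define S where "S = (\<lambda>\<omega>. \<Sum>k\<in>J. a k * \<xi> k \<omega>)"
  have [measurable]: "S \<in> borel_measurable M" unfolding S_def by measurable
  have S2: "integrable M (\<lambda>\<omega>. (norm (S \<omega>))\<^sup>2)"
    unfolding S_def by (rule spectral_isometry(1)[OF J])
  have S1: "integrable M S" unfolding S_def using xi_integrable by auto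
  have mean: "expectation S = 0"
    unfolding S_def using xi_integrable cent by (simp add: Bochner_Integration.integral_sum centered_def)
  have gRe: "real_gaussian M (\<lambda>\<omega>. Re (S \<omega>))"
  proof -
    have "real_gaussian M (\<lambda>\<omega>. \<Sum>k\<in>J. Re (a k) * Re (\<xi> k \<omega>) + (- Im (a k)) * Im (\<xi> k \<omega>))"
      by (rule linear_form_gaussian[OF J])
    then show ?thesis by (simp add: S_def Re_sum)
  qed
  have gIm: "real_gaussian M (\<lambda>\<omega>. Im (S \<omega>))"
  proof -
    have "real_gaussian M (\<lambda>\<omega>. \<Sum>k\<in>J. Im (a k) * Re (\<xi> k \<omega>) + Re (a k) * Im (\<xi> k \<omega>))"
      by (rule linear_form_gaussian[OF J])
    then show ?thesis by (simp add: S_def Im_sum add.commute)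
  qed
  have iRe: "integrable M (\<lambda>\<omega>. (Re (S \<omega>))\<^sup>2)" and iIm: "integrable M (\<lambda>\<omega>. (Im (S \<omega>))\<^sup>2)"
    by (rule Bochner_Integration.integrable_bound[OF S2]; force simp: cmod_power2)+
  have "(LINT \<omega>|M. (norm (S \<omega>))\<^sup>2) = (LINT \<omega>|M. (Re (S \<omega>))\<^sup>2) + (LINT \<omega>|M. (Im (S \<omega>))\<^sup>2)"
    unfolding cmod_power2 by (rule Bochner_Integration.integral_add[OF iRe iIm])
  then consider "v / 2 \<le> (LINT \<omega>|M. (Re (S \<omega>))\<^sup>2)" | "v / 2 \<le> (LINT \<omega>|M. (Im (S \<omega>))\<^sup>2)"
    using v unfolding S_def by linarith
  then have "prob {\<omega>\<in>space M. norm (S \<omega>) < e} \<le> e / sqrt (v / 2)"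
  proof cases
    case 1
    have "prob {\<omega>\<in>space M. norm (S \<omega>) < e} \<le> prob {\<omega>\<in>space M. \<bar>Re (S \<omega>)\<bar> < e}"
      by (intro finite_measure_mono) (auto intro: le_less_trans[OF abs_Re_le_cmod])
    also have "\<dots> \<le> e / sqrt (v / 2)"
      using 1 v e S1 mean by (intro real_gaussian_small_ball gRe iRe) auto
    finally show ?thesis .
  next
    case 2
    have "prob {\<omega>\<in>space M. norm (S \<omega>) < e} \<le> prob {\<omega>\<in>space M. \<bar>Im (S \<omega>)\<bar> < e}"
      by (intro finite_measure_mono) (auto intro: le_less_trans[OF abs_Im_le_cmod])
    also have "\<dots> \<le> e / sqrt (v / 2)"
      using 2 v e S1 mean by (intro real_gaussian_small_ball gIm iIm) auto
    finally show ?thesis .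
  qed
  also have "\<dots> = sqrt 2 * e / sqrt v" by (simp add: real_sqrt_divide)
  also have "\<dots> \<le> 2 * e / sqrt v"
    using v e by (intro divide_right_mono mult_right_mono) (auto intro: real_le_lsqrt)
  finally show ?thesis unfolding S_def .
qed

text \<open>The same facts for sums of consecutive variables, the shape in which the partial sums of a
  Taylor coefficient appear.\<close>
lemma spectral_isometry_nat:
  fixes w :: "nat \<Rightarrow> complex"
  shows "integrable M (\<lambda>\<omega>. (norm (\<Sum>k<N. w k * \<xi> (int (n + k)) \<omega>))\<^sup>2)"
    and "(LINT \<omega>|M. (norm (\<Sum>k<N. w k * \<xi> (int (n + k)) \<omega>))\<^sup>2)
      = (LINT t|F. (norm (\<Sum>k<N. w k * cis (- (real (n + k) * t))))\<^sup>2)"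
    and "0 < v \<Longrightarrow> v \<le> (LINT \<omega>|M. (norm (\<Sum>k<N. w k * \<xi> (int (n + k)) \<omega>))\<^sup>2) \<Longrightarrow> 0 < e \<Longrightarrow>
      prob {\<omega>\<in>space M. norm (\<Sum>k<N. w k * \<xi> (int (n + k)) \<omega>) < e} \<le> 2 * e / sqrt v"
proof -
  define J where "J = (\<lambda>k. int (n + k)) ` {..<N}"
  define a where "a = (\<lambda>j. w (nat j - n))"
  have J: "finite J" by (simp add: J_def)
  have reindex: "(\<Sum>k<N. w k * x (int (n + k))) = (\<Sum>j\<in>J. a j * x j)" for x
    unfolding J_def by (subst sum.reindex) (auto simp: inj_on_def a_def nat_add_distrib)
  have c: "real (n + k) = of_int (int (n + k))" for k by simp
  show "integrable M (\<lambda>\<omega>. (norm (\<Sum>k<N. w k * \<xi> (int (n + k)) \<omega>))\<^sup>2)"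
    unfolding reindex[of "\<lambda>j. \<xi> j _"] by (rule spectral_isometry(1)[OF J])
  show "(LINT \<omega>|M. (norm (\<Sum>k<N. w k * \<xi> (int (n + k)) \<omega>))\<^sup>2)
      = (LINT t|F. (norm (\<Sum>k<N. w k * cis (- (real (n + k) * t))))\<^sup>2)"
    unfolding reindex[of "\<lambda>j. \<xi> j _"] c reindex[of "\<lambda>j. cis (- (of_int j * _))"]
    by (rule spectral_isometry(2)[OF J])
  show "prob {\<omega>\<in>space M. norm (\<Sum>k<N. w k * \<xi> (int (n + k)) \<omega>) < e} \<le> 2 * e / sqrt v"
    if "0 < v" "v \<le> (LINT \<omega>|M. (norm (\<Sum>k<N. w k * \<xi> (int (n + k)) \<omega>))\<^sup>2)" "0 < e"
    using that unfolding reindex[of "\<lambda>j. \<xi> j _"] by (intro small_ball_finite[OF J])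
qed

lemma AE_conv_radius_ge_1: "AE \<omega> in M. fps_conv_radius (random_power_series \<xi> \<omega>) \<ge> 1"
proof -
  have "AE \<omega> in M. conv_radius (\<lambda>n. \<xi> (int n) \<omega>) \<ge> ereal (1 - 1 / real (m + 2))" for m
  proof (rule AE_conv_radius_ge_if_second_moments[where K = 1 and q = 1])
    fix n
    have "(LINT \<omega>|M. (norm (\<xi> (int n) \<omega>))\<^sup>2) = 1"
      using spectral_isometry(2)[of "{int n}" "\<lambda>_. 1"] F.prob_space by simp
    then show "(\<integral>\<^sup>+\<omega>. ennreal ((norm (\<xi> (int n) \<omega>))\<^sup>2) \<partial>M) \<le> ennreal (1 * 1 ^ n)"
      using nn_integral_eq_integral[OF xi_square_integrable] by simp
    have "1 - 1 / real (m + 2) < 1" "1 - 1 / real (m + 2) > 0" by (auto simp: field_simps)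
    then show "1 - 1 / real (m + 2) > 0" "(1 - 1 / real (m + 2))\<^sup>2 * 1 < 1"
      using power_strict_mono[of "1 - 1 / real (m + 2)" 1 2] by auto
  qed auto
  then have "AE \<omega> in M. \<forall>m. conv_radius (\<lambda>n. \<xi> (int n) \<omega>) \<ge> ereal (1 - 1 / real (m + 2))"
    by (simp add: AE_all_countable)
  then show ?thesis
  proof eventually_elim
    case (elim \<omega>)
    have "(\<lambda>m. 1 - 1 / real (m + 2)) \<longlonglongrightarrow> 1" by real_asymp
    then have "(\<lambda>m. ereal (1 - 1 / real (m + 2))) \<longlonglongrightarrow> ereal 1"
      by (rule tendsto_ereal)
    then have "ereal 1 \<le> conv_radius (\<lambda>n. \<xi> (int n) \<omega>)"
      by (rule LIMSEQ_le_const2) (use elim in auto)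
    then show ?case
      by (simp add: random_power_series_def fps_conv_radius_def one_ereal_def)
  qed
qed

section \<open>The random Taylor coefficients at a point of the disc\<close>

definition taylor_coeff :: "complex \<Rightarrow> nat \<Rightarrow> 'a \<Rightarrow> complex" where
  "taylor_coeff a n \<omega> = fps_nth (recentred (random_power_series \<xi> \<omega>) a) n"

definition taylor_sum :: "complex \<Rightarrow> nat \<Rightarrow> nat \<Rightarrow> 'a \<Rightarrow> complex" where
  "taylor_sum a n N \<omega> = (\<Sum>k<N. of_nat ((n + k) choose n) * a ^ k * \<xi> (int (n + k)) \<omega>)"

text \<open>The limit of the second moments of the partial sums \<open>taylor_sum a n N\<close>: a frequency \<open>u = cis t\<close> contributes
  \<open>1 / (1 - z / u)\<close>, whose \<open>n\<close>-th Taylor coefficient at \<open>a\<close> has modulus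
  \<open>|u - a|^(-(n + 1))\<close>.\<close>
definition taylor_variance :: "complex \<Rightarrow> nat \<Rightarrow> real" where
  "taylor_variance a n = (LINT t|F. 1 / norm (cis t - a) ^ (2 * Suc n))"

lemma taylor_coeff_measurable [measurable]: "taylor_coeff a n \<in> borel_measurable M"
  unfolding taylor_coeff_def recentred_def random_power_series_def by simp

lemma taylor_sum_measurable [measurable]: "taylor_sum a n N \<in> borel_measurable M"
  unfolding taylor_sum_def by measurable

lemma AE_taylor_sum_tendsto:
  assumes "norm a < 1"
  shows "AE \<omega> in M. (\<lambda>N. taylor_sum a n N \<omega>) \<longlonglongrightarrow> taylor_coeff a n \<omega>"
  using AE_conv_radius_ge_1
proof eventually_elim
  case (elim \<omega>)
  have "ereal (norm a) < 1" using assms by (simp add: one_ereal_def)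
  also note elim
  finally show ?case
    using recentred_eq_fps_expansion(2)[of a "random_power_series \<xi> \<omega>" n]
    by (simp add: sums_def taylor_sum_def taylor_coeff_def random_power_series_def)
qed

lemma taylor_variance_integrable:
  assumes "norm a < 1"
  shows "integrable F (\<lambda>t. 1 / norm (cis t - a) ^ (2 * Suc n))"
proof (rule F.integrable_const_bound)
  have "norm (1 / norm (cis t - a) ^ m) \<le> 1 / (1 - norm a) ^ m" for t m
  proof -
    have "1 - norm a \<le> norm (cis t - a)"
      using norm_triangle_ineq2[of "cis t" a] by simp
    then have "(1 - norm a) ^ m \<le> norm (cis t - a) ^ m" using assms by (intro power_mono) auto
    then show ?thesis using assms by (simp add: norm_power frac_le)
  qed
  then show "AE t in F. norm (1 / norm (cis t - a) ^ (2 * Suc n)) \<le> 1 / (1 - norm a) ^ (2 * Suc n)"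
    by (intro AE_I2)
qed measurable

text \<open>On the spectral side the partial sums are those of a negative binomial series; they converge
  at every frequency and are bounded uniformly in the frequency because \<open>|a| < 1\<close>.\<close>
lemma taylor_sum_variance_tendsto:
  assumes a: "norm a < 1"
  shows "(\<lambda>N. LINT \<omega>|M. (norm (taylor_sum a n N \<omega>))\<^sup>2) \<longlonglongrightarrow> taylor_variance a n"
proof -
  let ?w = "\<lambda>k. of_nat ((n + k) choose n) * a ^ k"
  let ?s = "\<lambda>N t. \<Sum>k<N. ?w k * cis (- (real (n + k) * t))"
  have sn: "summable (\<lambda>k. real ((n + k) choose n) * norm a ^ k)"
  proof -
    have "summable (\<lambda>k. complex_of_real (real ((n + k) choose n) * norm a ^ k))"
      using negative_binomial_series[of "complex_of_real (norm a)" n] a by (auto simp: sums_iff)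
    then show ?thesis by (simp only: summable_complex_of_real)
  qed
  define B where "B = (\<Sum>k. real ((n + k) choose n) * norm a ^ k)"
  have bound: "norm (?s N t) \<le> B" for N t
  proof -
    have "norm (?s N t) \<le> (\<Sum>k<N. real ((n + k) choose n) * norm a ^ k)"
      by (rule order_trans[OF norm_sum]) (simp add: norm_mult norm_power)
    also have "\<dots> \<le> B" unfolding B_def by (rule sum_le_suminf[OF sn]) auto
    finally show ?thesis .
  qed
  have lim: "(\<lambda>N. (norm (?s N t))\<^sup>2) \<longlonglongrightarrow> 1 / norm (cis t - a) ^ (2 * Suc n)" for t
  proof -
    let ?u = "cis (- t)"
    have "(\<lambda>k. of_nat ((n + k) choose n) * (a * ?u) ^ k * ?u ^ n) sums (1 / (1 - a * ?u) ^ Suc n * ?u ^ n)"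
      by (intro sums_mult2 negative_binomial_series) (use a in \<open>simp add: norm_mult\<close>)
    also have "(\<lambda>k. of_nat ((n + k) choose n) * (a * ?u) ^ k * ?u ^ n)
        = (\<lambda>k. ?w k * cis (- (real (n + k) * t)))"
    proof
      fix k
      have "?u ^ k * ?u ^ n = cis (- (real (n + k) * t))"
        unfolding Complex.DeMoivre cis_mult by (simp add: algebra_simps)
      moreover have "of_nat ((n + k) choose n) * (a * ?u) ^ k * ?u ^ n = ?w k * (?u ^ k * ?u ^ n)"
        by (simp only: power_mult_distrib mult_ac)
      ultimately show "of_nat ((n + k) choose n) * (a * ?u) ^ k * ?u ^ n = ?w k * cis (- (real (n + k) * t))"
        by simp
    qed
    finally have "(\<lambda>N. norm (?s N t)) \<longlonglongrightarrow> norm (1 / (1 - a * ?u) ^ Suc n * ?u ^ n)"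
      unfolding sums_def by (rule tendsto_norm)
    moreover have "norm (1 - a * ?u) = norm (cis t - a)"
    proof -
      have "cis t - a = cis t * (1 - a * ?u)" by (simp add: algebra_simps cis_mult)
      then show ?thesis by (simp add: norm_mult)
    qed
    ultimately have "(\<lambda>N. norm (?s N t)) \<longlonglongrightarrow> 1 / norm (cis t - a) ^ Suc n"
      by (simp add: norm_mult norm_divide norm_power del: power_Suc)
    from tendsto_power[OF this, of 2] show ?thesis
      by (simp add: power_divide power_mult[symmetric] mult.commute del: power_Suc)
  qed
  have "(\<lambda>N. LINT t|F. (norm (?s N t))\<^sup>2) \<longlonglongrightarrow> taylor_variance a n"
    unfolding taylor_variance_def
  proof (rule integral_dominated_convergence[where w = "\<lambda>_. B\<^sup>2"])
    show "AE t in F. norm ((norm (?s N t))\<^sup>2) \<le> B\<^sup>2" for N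
      using bound by (intro AE_I2) (simp add: power_mono)
  qed (use lim in auto)
  then show ?thesis
    unfolding taylor_sum_def spectral_isometry_nat(2) .
qed

text \<open>Fatou's lemma transfers the upper bound from the partial sums to their almost sure limit.\<close>
lemma taylor_coeff_second_moment:
  assumes a: "norm a < 1"
  shows "(\<integral>\<^sup>+\<omega>. ennreal ((norm (taylor_coeff a n \<omega>))\<^sup>2) \<partial>M) \<le> ennreal (taylor_variance a n)"
proof -
  let ?f = "\<lambda>N \<omega>. ennreal ((norm (taylor_sum a n N \<omega>))\<^sup>2)"
  have "(\<integral>\<^sup>+\<omega>. ennreal ((norm (taylor_coeff a n \<omega>))\<^sup>2) \<partial>M) = (\<integral>\<^sup>+\<omega>. liminf (\<lambda>N. ?f N \<omega>) \<partial>M)"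
  proof (rule nn_integral_cong_AE)
    show "AE \<omega> in M. ennreal ((norm (taylor_coeff a n \<omega>))\<^sup>2) = liminf (\<lambda>N. ?f N \<omega>)"
      using AE_taylor_sum_tendsto[OF a, of n]
    proof eventually_elim
      case (elim \<omega>)
      then have "(\<lambda>N. ?f N \<omega>) \<longlonglongrightarrow> ennreal ((norm (taylor_coeff a n \<omega>))\<^sup>2)"
        by (intro tendsto_ennrealI tendsto_intros)
      then show ?case by (rule lim_imp_Liminf[OF trivial_limit_sequentially, symmetric])
    qed
  qed
  also have "\<dots> \<le> liminf (\<lambda>N. \<integral>\<^sup>+\<omega>. ?f N \<omega> \<partial>M)"
    by (intro nn_integral_liminf) measurable
  also have "(\<lambda>N. \<integral>\<^sup>+\<omega>. ?f N \<omega> \<partial>M) = (\<lambda>N. ennreal (LINT \<omega>|M. (norm (taylor_sum a n N \<omega>))\<^sup>2))"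
    unfolding taylor_sum_def by (intro ext nn_integral_eq_integral spectral_isometry_nat) auto
  also have "liminf \<dots> = ennreal (taylor_variance a n)"
    by (intro lim_imp_Liminf tendsto_ennrealI taylor_sum_variance_tendsto a) simp
  finally show ?thesis .
qed

text \<open>Small-ball estimates pass to almost sure limits as well: where the limit lies in the open
  ball, so do the partial sums from some index on.\<close>
lemma taylor_coeff_small_ball:
  assumes a: "norm a < 1" and v: "0 < v" "v < taylor_variance a n" and e: "e > 0"
  shows "prob {\<omega>\<in>space M. norm (taylor_coeff a n \<omega>) < e} \<le> 2 * e / sqrt v"
proof -
  let ?A = "{\<omega>\<in>space M. norm (taylor_coeff a n \<omega>) < e}"
  let ?B = "\<lambda>N. {\<omega>\<in>space M. norm (taylor_sum a n N \<omega>) < e}"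
  have "emeasure M ?A = (\<integral>\<^sup>+\<omega>. indicator ?A \<omega> \<partial>M)" by simp
  also have "\<dots> \<le> (\<integral>\<^sup>+\<omega>. liminf (\<lambda>N. indicator (?B N) \<omega>) \<partial>M)"
  proof (rule nn_integral_mono_AE)
    show "AE \<omega> in M. (indicator ?A \<omega> :: ennreal) \<le> liminf (\<lambda>N. indicator (?B N) \<omega>)"
      using AE_taylor_sum_tendsto[OF a, of n] AE_space
    proof eventually_elim
      case (elim \<omega>)
      show ?case
      proof (cases "\<omega> \<in> ?A")
        case True
        have "eventually (\<lambda>N. norm (taylor_sum a n N \<omega>) < e) sequentially"
          using True by (intro order_tendstoD(2)[OF tendsto_norm[OF elim(1)]]) auto
        then have "eventually (\<lambda>N. (1 :: ennreal) \<le> indicator (?B N) \<omega>) sequentially"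
          by eventually_elim (use elim in auto)
        then show ?thesis using True by (intro Liminf_bounded) (auto elim: eventually_mono)
      qed auto
    qed
  qed
  also have "\<dots> \<le> liminf (\<lambda>N. \<integral>\<^sup>+\<omega>. indicator (?B N) \<omega> \<partial>M)"
    by (intro nn_integral_liminf) measurable
  also have "\<dots> \<le> liminf (\<lambda>N. ennreal (2 * e / sqrt v))"
  proof (rule Liminf_mono)
    have "eventually (\<lambda>N. v < (LINT \<omega>|M. (norm (taylor_sum a n N \<omega>))\<^sup>2)) sequentially"
      using v by (intro order_tendstoD(1)[OF taylor_sum_variance_tendsto[OF a]])
    then show "eventually (\<lambda>N. (\<integral>\<^sup>+\<omega>. indicator (?B N) \<omega> \<partial>M) \<le> ennreal (2 * e / sqrt v)) sequentially"
    proof eventually_elim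
      case (elim N)
      then have "prob (?B N) \<le> 2 * e / sqrt v"
        using v e unfolding taylor_sum_def by (intro spectral_isometry_nat(3)) auto
      then show ?case by (simp add: emeasure_eq_measure ennreal_leI)
    qed
  qed
  also have "\<dots> = ennreal (2 * e / sqrt v)" by (simp add: Liminf_const)
  finally show ?thesis using v e by (simp add: emeasure_eq_measure)
qed

section \<open>The support of the spectral measure\<close>

lemma circle_support_iff:
  "b \<in> circle_support F \<longleftrightarrow> (\<forall>e>0. 0 < F.prob (cis -` ball b e \<inter> space F))"
proof -
  have m: "emeasure (distr F borel cis) U = F.prob (cis -` U \<inter> space F)" if "open U" for U
    using that by (subst emeasure_distr) (auto simp: F.emeasure_eq_measure)
  show ?thesis
  proof
    assume "b \<in> circle_support F"
    then show "\<forall>e>0. 0 < F.prob (cis -` ball b e \<inter> space F)"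
      unfolding circle_support_def measure_support_def using m
      by (metis (no_types, lifting) CollectD centre_in_ball ennreal_less_zero_iff open_ball)
  next
    assume *: "\<forall>e>0. 0 < F.prob (cis -` ball b e \<inter> space F)"
    show "b \<in> circle_support F"
      unfolding circle_support_def measure_support_def
    proof (intro CollectI allI impI)
      fix U assume U: "open U \<and> b \<in> U"
      then obtain e where e: "e > 0" "ball b e \<subseteq> U" using openE by blast
      have "0 < emeasure (distr F borel cis) (ball b e)"
        using * e by (simp add: m)
      also have "\<dots> \<le> emeasure (distr F borel cis) U"
        using e U by (intro emeasure_mono) auto
      finally show "0 < emeasure (distr F borel cis) U" .
    qed
  qed
qed

lemma circle_support_subset: "circle_support F \<subseteq> sphere 0 1"
proof
  fix b assume b: "b \<in> circle_support F"
  show "b \<in> sphere 0 1"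
  proof (rule ccontr)
    assume "b \<notin> sphere 0 1"
    moreover have "open (- sphere (0::complex) 1)" by (simp add: open_Compl)
    ultimately obtain e where e: "e > 0" "ball b e \<subseteq> - sphere 0 1"
      using openE[of "- sphere (0::complex) 1" b] by auto
    then have "cis -` ball b e = {}" by auto
    with b e show False by (auto simp: circle_support_iff)
  qed
qed

text \<open>Otherwise the plane would be covered by open null sets, hence by countably many of them,
  against the total mass \<open>1\<close>.\<close>
lemma circle_support_nonempty: "circle_support F \<noteq> {}"
proof
  assume empty: "circle_support F = {}"
  define \<F> where "\<F> = {U. open U \<and> emeasure (distr F borel cis) U = 0}"
  have "\<Union>\<F> = UNIV"
    using empty unfolding circle_support_def measure_support_def \<F>_def
    by (auto simp: not_gr_zero)
  moreover obtain \<G> where \<G>: "\<G> \<subseteq> \<F>" "countable \<G>" "\<Union>\<G> = \<Union>\<F>"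
    using Lindelof[of \<F>] by (auto simp: \<F>_def)
  ultimately have "\<Union>\<G> = (UNIV :: complex set)" by simp
  moreover have "(\<Union>U\<in>\<G>. U) \<in> null_sets (distr F borel cis)"
    using \<G> by (intro null_sets_UN') (auto simp: \<F>_def null_sets_def)
  ultimately have "emeasure (distr F borel cis) UNIV = 0" by auto
  moreover have "emeasure (distr F borel cis) UNIV = 1"
    by (subst emeasure_distr) (auto simp: F.emeasure_space_1)
  ultimately show False by simp
qed

section \<open>Radius of convergence at midpoints versus the support\<close>

text \<open>Away from a disc around \<open>b\<close>, the points of the unit circle have distance at least
  \<open>s > 1/2\<close> from \<open>b / 2\<close>. If that disc carries no spectral mass, the second moments of the Taylor
  coefficients at \<open>b / 2\<close> are at most \<open>s^(-2(n + 1))\<close>.\<close>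
lemma AE_radius_at_half_outside_support:
  assumes b: "norm b = 1" "b \<notin> circle_support F"
  obtains r where "r > 1 / 2"
    "AE \<omega> in M. fps_conv_radius (recentred (random_power_series \<xi> \<omega>) (b / 2)) \<ge> ereal r"
proof -
  from b obtain e where e: "e > 0" "F.prob (cis -` ball b e \<inter> space F) = 0"
    unfolding circle_support_iff by (metis F.prob_space measure_nonneg order_le_less)
  \<comment> \<open>the least possible value of \<open>|u - b/2|\<close> when \<open>|u| = 1\<close> and \<open>|u - b| \<ge> e\<close>\<close>
  define s where "s = sqrt (1/4 + e\<^sup>2/2)"
  have s2: "s\<^sup>2 = 1/4 + e\<^sup>2/2" unfolding s_def by (simp add: add_nonneg_nonneg)
  have s: "s > 1/2"
    unfolding s_def using e by (intro real_less_rsqrt) (simp add: power2_eq_square)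
  then obtain r where r: "1/2 < r" "r < s" using dense by blast
  have a: "norm (b/2) < 1" using b by (simp add: norm_divide)
  have far: "s \<le> norm (cis t - b/2)" if "cis t \<notin> ball b e" for t
  proof -
    have "(norm (u - b/2))\<^sup>2 = (norm u)\<^sup>2 / 2 - (norm b)\<^sup>2 / 4 + (norm (u - b))\<^sup>2 / 2" for u
      unfolding cmod_power2 by (simp add: power2_eq_square field_simps)
    note this[of "cis t"]
    moreover have "e\<^sup>2 \<le> (norm (cis t - b))\<^sup>2"
      using that e by (intro power_mono) (auto simp: dist_norm norm_minus_commute)
    ultimately have "s\<^sup>2 \<le> (norm (cis t - b/2))\<^sup>2" using b s2 by simp
    then show ?thesis by (rule power2_le_imp_le) simp
  qed
  have AE: "AE t in F. cis t \<notin> ball b e"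
  proof (rule AE_I')
    show "cis -` ball b e \<inter> space F \<in> null_sets F"
      using e by (intro null_setsI) (auto simp: F.emeasure_eq_measure)
  qed auto
  have var: "taylor_variance (b/2) n \<le> (1 / s\<^sup>2) * (1 / s\<^sup>2) ^ n" for n
  proof -
    have "taylor_variance (b/2) n \<le> (LINT t|F. 1 / s ^ (2 * Suc n))"
      unfolding taylor_variance_def
    proof (rule integral_mono_AE)
      show "AE t in F. 1 / norm (cis t - b/2) ^ (2 * Suc n) \<le> 1 / s ^ (2 * Suc n)"
        using AE
      proof eventually_elim
        case (elim t)
        have "s ^ (2 * Suc n) \<le> norm (cis t - b/2) ^ (2 * Suc n)"
          using far[OF elim] s by (intro power_mono) auto
        then show ?case using s
          by (intro divide_left_mono mult_pos_pos zero_less_power)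
            (auto intro: less_le_trans[OF _ far[OF elim]] simp del: power_Suc mult_Suc_right)
      qed
    qed (auto intro!: taylor_variance_integrable a simp del: power_Suc mult_Suc_right)
    also have "\<dots> = (1 / s\<^sup>2) * (1 / s\<^sup>2) ^ n"
    proof -
      have "1 / s ^ (2 * Suc n) = (1 / s\<^sup>2) ^ Suc n" unfolding power_mult by (rule power_one_over[symmetric])
      then show ?thesis using F.prob_space by simp
    qed
    finally show ?thesis .
  qed
  have "AE \<omega> in M. conv_radius (\<lambda>n. taylor_coeff (b/2) n \<omega>) \<ge> ereal r"
  proof (rule AE_conv_radius_ge_if_second_moments)
    show "(\<integral>\<^sup>+\<omega>. ennreal ((norm (taylor_coeff (b/2) n \<omega>))\<^sup>2) \<partial>M)
        \<le> ennreal ((1 / s\<^sup>2) * (1 / s\<^sup>2) ^ n)" for n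
      using taylor_coeff_second_moment[OF a] var[THEN ennreal_leI] by (rule order_trans)
    have "r\<^sup>2 < s\<^sup>2" using r by (intro power_strict_mono) auto
    then show "r\<^sup>2 * (1 / s\<^sup>2) < 1" using s by (simp add: field_simps)
  qed (use r in auto)
  then show ?thesis
    using that[of r] r unfolding taylor_coeff_def fps_conv_radius_def by simp
qed

text \<open>The mass \<open>p > 0\<close> that the spectral measure gives to the disc of radius \<open>e\<close> around \<open>b\<close> lies
  within distance \<open>1/2 + e\<close> of \<open>b / 2\<close>. So the second moments are at least
  \<open>p (1/2 + e)^(-2(n + 1))\<close>, and the small-ball estimate bounds the radius of convergence by
  any number greater than \<open>1/2 + e\<close>.\<close>
lemma AE_radius_at_half_on_support:
  assumes b: "b \<in> circle_support F"
  shows "AE \<omega> in M. fps_conv_radius (recentred (random_power_series \<xi> \<omega>) (b / 2)) \<le> ereal (1 / 2)"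
proof -
  have b1: "norm b = 1" using b circle_support_subset by auto
  have a: "norm (b/2) < 1" using b1 by (simp add: norm_divide)
  have le: "AE \<omega> in M. conv_radius (\<lambda>n. taylor_coeff (b/2) n \<omega>) \<le> ereal (1/2 + 2 * e)" if e: "e > 0" for e
  proof -
    define p where "p = F.prob (cis -` ball b e \<inter> space F)"
    have p: "p > 0" using b e unfolding p_def circle_support_iff by auto
    define s where "s = 1/2 + e"
    have s: "s > 0" using e by (simp add: s_def)
    have near: "norm (cis t - b/2) \<le> s" if "cis t \<in> ball b e" for t
      using norm_triangle_ineq[of "cis t - b" "b/2"] that b1
      by (simp add: s_def dist_norm norm_minus_commute norm_divide)
    have pos: "norm (cis t - b/2) > 0" for t
      using norm_triangle_ineq2[of "cis t" "b/2"] a norm_cis[of t] by linarith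
    have var: "p / s ^ (2 * Suc n) \<le> taylor_variance (b/2) n" for n
    proof -
      have "p / s ^ (2 * Suc n)
          = (LINT t|F. 1 / s ^ (2 * Suc n) * indicator (cis -` ball b e \<inter> space F) t)"
        by (simp add: p_def)
      also have "\<dots> \<le> taylor_variance (b/2) n"
        unfolding taylor_variance_def
      proof (rule integral_mono)
        fix t
        show "1 / s ^ (2 * Suc n) * indicator (cis -` ball b e \<inter> space F) t
            \<le> 1 / norm (cis t - b/2) ^ (2 * Suc n)"
        proof (cases "cis t \<in> ball b e")
          case True
          then have "norm (cis t - b/2) ^ (2 * Suc n) \<le> s ^ (2 * Suc n)"
            using near by (intro power_mono) auto
          then have "1 / s ^ (2 * Suc n) \<le> 1 / norm (cis t - b/2) ^ (2 * Suc n)"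
            using s pos[of t] by (intro divide_left_mono mult_pos_pos zero_less_power) auto
          then show ?thesis
            by (auto simp: indicator_def simp del: power_Suc mult_Suc_right)
        qed auto
      qed (auto intro!: taylor_variance_integrable a integrable_mult_right integrable_real_indicator
          simp: F.emeasure_eq_measure simp del: power_Suc mult_Suc_right)
      finally show ?thesis .
    qed
    have sb: "prob {\<omega>\<in>space M. norm (taylor_coeff (b/2) n \<omega>) < d} \<le> (4 * s / sqrt p) * d * s ^ n"
      if d: "d > 0" for n d
    proof -
      \<comment> \<open>the factor \<open>2\<close> makes \<open>?v\<close> strictly smaller than the second moment\<close>
      let ?v = "p / (2 * s ^ Suc n)\<^sup>2"
      have v: "0 < ?v" using p s by simp
      have "?v = p / s ^ (2 * Suc n) / 4"
        by (simp add: power_mult_distrib power_mult[symmetric] mult.commute del: power_Suc mult_Suc_right)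
      also have "\<dots> < p / s ^ (2 * Suc n)"
      proof -
        have "x / 4 < x" if "x > 0" for x :: real using that by simp
        then show ?thesis using p s by (blast intro: divide_pos_pos zero_less_power)
      qed
      also note var
      finally have "?v < taylor_variance (b/2) n" .
      then have "prob {\<omega>\<in>space M. norm (taylor_coeff (b/2) n \<omega>) < d} \<le> 2 * d / sqrt ?v"
        using d v a by (intro taylor_coeff_small_ball)
      also have "sqrt ?v = sqrt p / (2 * s ^ Suc n)"
        unfolding real_sqrt_divide real_sqrt_abs using s by simp
      finally show ?thesis using s p by (simp add: field_simps)
    qed
    show ?thesis
      by (rule AE_conv_radius_le_if_small_ball[OF _ sb]) (use s e in \<open>auto simp: s_def\<close>)
  qed
  have "AE \<omega> in M. \<forall>m. conv_radius (\<lambda>n. taylor_coeff (b/2) n \<omega>) \<le> ereal (1/2 + 2 * (1 / real (Suc m)))"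
    unfolding AE_all_countable by (intro allI le) simp
  then show ?thesis
  proof eventually_elim
    case (elim \<omega>)
    have "(\<lambda>m. 1/2 + 2 * (1 / real (Suc m))) \<longlonglongrightarrow> 1/2" by real_asymp
    then have "(\<lambda>m. ereal (1/2 + 2 * (1 / real (Suc m)))) \<longlonglongrightarrow> ereal (1/2)"
      by (rule tendsto_ereal)
    then have "conv_radius (\<lambda>n. taylor_coeff (b/2) n \<omega>) \<le> ereal (1/2)"
      by (rule LIMSEQ_le_const) (use elim in auto)
    then show ?case unfolding taylor_coeff_def fps_conv_radius_def .
  qed
qed

section \<open>The regular set\<close>

text \<open>A radius of convergence greater than \<open>1\<close> would carry the function past every point
  \<open>b\<close> of the unit circle and make the radius at \<open>b / 2\<close> exceed \<open>1/2\<close>. For \<open>b\<close> in the support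
  it does not.\<close>
lemma AE_conv_radius_eq_1: "AE \<omega> in M. fps_conv_radius (random_power_series \<xi> \<omega>) = 1"
proof -
  obtain b where b: "b \<in> circle_support F" using circle_support_nonempty by auto
  then have b1: "norm b = 1" using circle_support_subset by auto
  show ?thesis
    using AE_radius_at_half_on_support[OF b] AE_conv_radius_ge_1
  proof eventually_elim
    case (elim \<omega>)
    let ?h = "random_power_series \<xi> \<omega>"
    show ?case
    proof (rule ccontr)
      assume "fps_conv_radius ?h \<noteq> 1"
      with elim(2) have gt: "fps_conv_radius ?h > 1" by simp
      have "fps_conv_radius (recentred ?h (b/2)) > ereal (1/2)"
      proof (rule radius_at_half_gt[OF b1 elim(2)])
        show "open (eball 0 (fps_conv_radius ?h))" by simp
        show "ball 0 1 \<subseteq> eball 0 (fps_conv_radius ?h)"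
          using elim(2) by (intro ball_eball_mono) (simp add: one_ereal_def)
        show "b \<in> eball 0 (fps_conv_radius ?h)" using gt b1 by (simp add: one_ereal_def)
        show "eval_fps ?h holomorphic_on eball 0 (fps_conv_radius ?h)"
          by (rule holomorphic_on_eval_fps) simp
      qed simp
      with elim(1) show False
        by simp
    qed
  qed
qed

text \<open>Each point outside the support has a neighbourhood that is regular off a null event. There
  are uncountably many points, but by the Lindelof property countably many of the neighbourhoods
  suffice.\<close>
lemma AE_regular_outside_support:
  "AE \<omega> in M. sphere 0 1 - circle_support F \<subseteq> regular_set (random_power_series \<xi> \<omega>)"
proof -
  let ?h = "\<lambda>\<omega>. random_power_series \<xi> \<omega>"
  define \<F> where "\<F> = {U. open U \<and> (AE \<omega> in M. U \<inter> sphere 0 1 \<subseteq> regular_set (?h \<omega>))}"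
  have cover: "b \<in> \<Union>\<F>" if b: "b \<in> sphere 0 1 - circle_support F" for b
  proof -
    from b obtain r where r: "r > 1/2"
      "AE \<omega> in M. fps_conv_radius (recentred (?h \<omega>) (b / 2)) \<ge> ereal r"
      using AE_radius_at_half_outside_support[of b] by auto
    have "AE \<omega> in M. ball (b/2) r \<inter> sphere 0 1 \<subseteq> regular_set (?h \<omega>)"
      using r(2) AE_conv_radius_eq_1
    proof eventually_elim
      case (elim \<omega>)
      then show ?case
        using regular_if_radius_at_half_gt[of b "?h \<omega>" r] b r(1) by auto
    qed
    then have "ball (b/2) r \<in> \<F>" by (simp add: \<F>_def)
    moreover have "b \<in> ball (b/2) r" using b r(1) by (simp add: dist_norm norm_divide)
    ultimately show ?thesis by blast
  qed
  obtain \<G> where \<G>: "\<G> \<subseteq> \<F>" "countable \<G>" "\<Union>\<G> = \<Union>\<F>"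
    using Lindelof[of \<F>] by (auto simp: \<F>_def)
  have "AE \<omega> in M. \<forall>U\<in>\<G>. U \<inter> sphere 0 1 \<subseteq> regular_set (?h \<omega>)"
    using \<G> by (auto simp: AE_ball_countable \<F>_def)
  then show ?thesis
    by eventually_elim (use cover \<G>(3) in blast)
qed

text \<open>Again only countably many points can be treated one by one. It is enough to do so for a
  dense subset of the support: a continuation near one point of the support is a continuation near
  some point of that subset.\<close>
lemma AE_singular_on_support:
  "AE \<omega> in M. regular_set (random_power_series \<xi> \<omega>) \<inter> circle_support F = {}"
proof -
  let ?h = "\<lambda>\<omega>. random_power_series \<xi> \<omega>"
  obtain D where D: "countable D" "D \<subseteq> circle_support F" "circle_support F \<subseteq> closure D"
    using separable[of "circle_support F"] by blast
  have "AE \<omega> in M. \<forall>b\<in>D. fps_conv_radius (recentred (?h \<omega>) (b / 2)) \<le> ereal (1 / 2)"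
    using D AE_radius_at_half_on_support by (subst AE_ball_countable) auto
  then show ?thesis using AE_conv_radius_eq_1
  proof eventually_elim
    case (elim \<omega>)
    show ?case
    proof (rule ccontr)
      assume "regular_set (?h \<omega>) \<inter> circle_support F \<noteq> {}"
      then obtain c where c: "c \<in> regular_set (?h \<omega>)" "c \<in> closure D" using D by auto
      from continues_near_if_regular[OF c(1) elim(2)] obtain U g where U:
        "open U" "c \<in> U" "g holomorphic_on (ball 0 1 \<union> U)"
        "\<And>z. z \<in> ball 0 1 \<Longrightarrow> g z = eval_fps (?h \<omega>) z" by metis
      then obtain b where b: "b \<in> D" "b \<in> U"
        using c(2) by (meson closure_iff_nhds_not_empty disjoint_iff order_refl)
      have "norm b = 1" using b D circle_support_subset by auto
      then have "fps_conv_radius (recentred (?h \<omega>) (b / 2)) > ereal (1 / 2)"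
        using U b elim(2) by (intro radius_at_half_gt[where V = "ball 0 1 \<union> U" and g = g]) auto
      with elim(1) b show False
        by force
    qed
  qed
qed

end

theorem theorem2p5:
  fixes M :: "'a measure" and \<xi> :: "int \<Rightarrow> 'a \<Rightarrow> complex"
    and \<gamma> :: "int \<Rightarrow> complex" and F :: "real measure"
  assumes "prob_space M"
    and "complex_gaussian_process M \<xi>"
    and "centered M \<xi>"
    and "circularly_symmetric M \<xi>"
    and "stationary M \<xi>"
    and "has_covariance M \<xi> \<gamma>"
    and "\<gamma> 0 = 1"
    and "spectral_measure \<gamma> F"
  shows "AE \<omega> in M. regular_set (random_power_series \<xi> \<omega>) = sphere 0 1 - circle_support F"
proof -
  interpret prob_space M by fact
  have e: "exp (- (\<i> * of_int k * of_real t)) = cis (- (of_int k * t))" for k t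
    by (simp add: cis_conv_exp mult_ac)
  interpret spectral_gaussian_process M \<xi> F
  proof (intro spectral_gaussian_process.intro spectral_gaussian_process_axioms.intro)
    show "prob_space M" by fact
    show "complex_gaussian_process M \<xi>" "centered M \<xi>" by fact+
    show "prob_space F" "sets F = sets (restrict_space borel {-pi<..pi})"
      using \<open>spectral_measure \<gamma> F\<close> unfolding spectral_measure_def by blast+
    fix k l
    have "(LINT \<omega>|M. \<xi> k \<omega> * cnj (\<xi> l \<omega>)) = \<gamma> (k - l)"
      using \<open>has_covariance M \<xi> \<gamma>\<close> unfolding has_covariance_def by metis
    also have "\<dots> = (LINT t|F. exp (- (\<i> * of_int (k - l) * of_real t)))"
      using \<open>spectral_measure \<gamma> F\<close> unfolding spectral_measure_def by blast
    finally show "(LINT \<omega>|M. \<xi> k \<omega> * cnj (\<xi> l \<omega>)) = (LINT t|F. cis (- (of_int (k - l) * t)))"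
      unfolding e .
  qed
  show ?thesis
    using AE_regular_outside_support AE_singular_on_support AE_conv_radius_eq_1
  proof eventually_elim
    case (elim \<omega>)
    moreover have "regular_set (random_power_series \<xi> \<omega>) \<subseteq> sphere 0 1"
      using continues_near_if_regular[OF _ elim(3)] by (metis mem_sphere_0 subsetI)
    ultimately show ?case by blast
  qed
qed

end
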